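(* Let $K$ be a field. If $\mathcal{D}$ is a weighted acyclic tournament with vertex set $\{x_1,\ldots,x_n\}$ and $I(\mathcal{D})\subset K[x_1,\ldots,x_n]$ is its edge ideal, then $I(\mathcal{D})^*=I(\mathcal{D})^\vee$, that is, Alexander duality holds.
   Context: An oriented graph $\mathcal{D}$ is a finite simple graph together with an orientation of each of its edges; $V(\mathcal{D})$ is its vertex set and $E(\mathcal{D})$ is its set of arrows $(x_i,x_j)$ (from $x_i$ to $x_j$). A tournament is an oriented graph whose underlying graph is complete; it is acyclic if it has no oriented cycles. $\mathcal{D}$ is weighted if it is endowed with a function $d\colon V(\mathcal{D})\to\mathbb{N}_+=\{1,2,\ldots\}$; write $d_i=d(x_i)$. Standing convention: if a vertex $x_i$ is a source (it has only arrows leaving it), then $d_i=1$. The edge ideal is $I(\mathcal{D})=(x_ix_j^{d_j}\mid (x_i,x_j)\in E(\mathcal{D}))\subset R=K[x_1,\ldots,x_n]$. For a monomial ideal $I\subset R$, $G(I)$ denotes its unique minimal generating set of monomials. An ideal is irreducible if it is not an intersection of two ideals properly containing it; the irreducible monomial ideals of $R$ are, up to permutation of the variables, the ideals $(x_1^{a_1},\ldots,x_r^{a_r})$ with all $a_i\geq 1$. Every monomial ideal has a unique irredundant decomposition $I=I_1\cap\cdots\cap I_m$ into irreducible monomial ideals; $I_1,\ldots,I_m$ are the irreducible components of $I$. The Alexander dual of $I$ is $$I^\vee=\Bigl(\prod_{f\in G(I_1)}f,\ \ldots,\ \prod_{f\in G(I_m)}f\Bigr),$$ and the dual of $I$ is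 $$I^*=\bigcap_{x^a\in G(I)}(\{x_i^{a_i}\mid a_i\geq 1\}),$$ where $x^a=x_1^{a_1}\cdots x_n^{a_n}$ for $a=(a_1,\ldots,a_n)$. *)

theory Defs
  imports Complex_Main "HOL-Library.Poly_Mapping"
begin

section \<open>Polynomials and ideals\<close>

text \<open>
  Polynomials over \<open>'k\<close> in variables indexed by \<open>'v\<close> are finitely supported functions from
  exponent vectors to coefficients. For finite \<open>'v\<close> and a field \<open>'k\<close> this is
  \<open>K[x\<^sub>1, \<dots>, x\<^sub>n]\<close>.
\<close>

type_synonym ('v, 'k) mpoly = "('v \<Rightarrow>\<^sub>0 nat) \<Rightarrow>\<^sub>0 'k"

definition monom :: "('v \<Rightarrow>\<^sub>0 nat) \<Rightarrow> ('v, 'k::comm_ring_1) mpoly" where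
  "monom a = Poly_Mapping.single a 1"

definition var :: "'v \<Rightarrow> ('v, 'k::comm_ring_1) mpoly" where
  "var v = monom (Poly_Mapping.single v 1)"

text \<open>The ideals of a commutative ring are its submodules as a module over itself.\<close>

lemma module_times: "module ((*) :: 'a::comm_ring_1 \<Rightarrow> 'a \<Rightarrow> 'a)"
  by unfold_locales (simp_all add: algebra_simps)

abbreviation is_ideal :: "'a::comm_ring_1 set \<Rightarrow> bool" where
  "is_ideal \<equiv> module.subspace (*)"

abbreviation ideal_gen :: "'a::comm_ring_1 set \<Rightarrow> 'a set" where
  "ideal_gen \<equiv> module.span (*)"

definition monomial_ideal :: "('v, 'k::comm_ring_1) mpoly set \<Rightarrow> bool" where
  "monomial_ideal I \<longleftrightarrow> (\<exists>S \<subseteq> range monom. I = ideal_gen S)"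

text \<open>\<open>G(I)\<close>; existence and uniqueness hold for monomial ideals \<open>I\<close>.\<close>

definition min_gens :: "('v, 'k::comm_ring_1) mpoly set \<Rightarrow> ('v, 'k) mpoly set" where
  "min_gens I =
     (THE S. S \<subseteq> range monom \<and> ideal_gen S = I \<and> (\<forall>T. T \<subset> S \<longrightarrow> ideal_gen T \<noteq> I))"

text \<open>
  The ideals \<open>J\<close> and \<open>L\<close> range over all ideals, not just monomial ones. The unit ideal is
  not counted as irreducible.
\<close>

definition irreducible_ideal :: "'a::comm_ring_1 set \<Rightarrow> bool" where
  "irreducible_ideal I \<longleftrightarrow> is_ideal I \<and> I \<noteq> UNIV \<and>
     \<not> (\<exists>J L. is_ideal J \<and> is_ideal L \<and> I \<subset> J \<and> I \<subset> L \<and> I = J \<inter> L)"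

definition irredundant_irreducible_decomp ::
    "('v, 'k::comm_ring_1) mpoly set \<Rightarrow> ('v, 'k) mpoly set set \<Rightarrow> bool" where
  "irredundant_irreducible_decomp I C \<longleftrightarrow>
     finite C \<and> (\<forall>J\<in>C. monomial_ideal J \<and> irreducible_ideal J) \<and> I = \<Inter>C \<and>
     (\<forall>J\<in>C. I \<noteq> \<Inter>(C - {J}))"

text \<open>Existence and uniqueness hold for monomial ideals in finitely many variables over a field.\<close>

definition irreducible_components ::
    "('v, 'k::comm_ring_1) mpoly set \<Rightarrow> ('v, 'k) mpoly set set" where
  "irreducible_components I = (THE C. irredundant_irreducible_decomp I C)"

text \<open>\<open>I\<^sup>\<or>\<close>\<close>

definition alexander_dual :: "('v, 'k::comm_ring_1) mpoly set \<Rightarrow> ('v, 'k) mpoly set" where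
  "alexander_dual I = ideal_gen ((\<lambda>J. \<Prod>f\<in>min_gens J. f) ` irreducible_components I)"

text \<open>\<open>I\<^sup>*\<close>; for \<open>I = 0\<close> the intersection is empty, giving the whole ring.\<close>

definition dual_ideal :: "('v, 'k::comm_ring_1) mpoly set \<Rightarrow> ('v, 'k) mpoly set" where
  "dual_ideal I =
     (\<Inter>a \<in> {a. monom a \<in> min_gens I}.
        ideal_gen {var v ^ Poly_Mapping.lookup a v | v. Poly_Mapping.lookup a v \<ge> 1})"


section \<open>Weighted oriented graphs\<close>

text \<open>
  The vertex set is the whole (finite) type \<open>'v\<close> and \<open>E\<close> is the set of arrows. Asymmetry
  excludes loops and says that every edge carries only one of its two orientations.
\<close>

definition oriented_graph :: "'v::finite rel \<Rightarrow> bool" where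
  "oriented_graph E \<longleftrightarrow> asym E"

definition tournament :: "'v::finite rel \<Rightarrow> bool" where
  "tournament E \<longleftrightarrow> oriented_graph E \<and> total E"

definition source_vertex :: "'v rel \<Rightarrow> 'v \<Rightarrow> bool" where
  "source_vertex E v \<longleftrightarrow> (\<forall>u. (u, v) \<notin> E)"

definition weighting :: "'v rel \<Rightarrow> ('v \<Rightarrow> nat) \<Rightarrow> bool" where
  "weighting E d \<longleftrightarrow> (\<forall>v. d v \<ge> 1) \<and> (\<forall>v. source_vertex E v \<longrightarrow> d v = 1)"

definition edge_ideal :: "'v rel \<Rightarrow> ('v \<Rightarrow> nat) \<Rightarrow> ('v, 'k::comm_ring_1) mpoly set" where
  "edge_ideal E d = ideal_gen {var u * var v ^ d v | u v. (u, v) \<in> E}"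

end

theory Submission
  imports Defs
begin

text \<open>
  Write \<open>x\<^sub>1, \<dots>, x\<^sub>n\<close> for the vertices in the linear order given by the acyclic tournament, so that
  the minimal generators of \<open>I\<close> are \<open>x\<^sub>i x\<^sub>j ^ d\<^sub>j\<close> with \<open>i < j\<close>: they have distinct supports of size
  two, hence none divides another. Both sides of the theorem are monomial ideals, so it suffices to
  compare the monomials in them.

  A monomial \<open>x\<^sup>a\<close> lies outside \<open>I\<close> if and only if, for some \<open>k\<close>, it is prime to \<open>x\<^sub>i\<close> for
  \<open>i < k\<close> and \<open>a\<^sub>j < d\<^sub>j\<close> for \<open>j > k\<close>: take for \<open>k\<close> the first index with \<open>a\<^sub>k > 0\<close>, or any index at all
  if \<open>a = 0\<close>. Therefore \<open>I\<close> is the intersection of the ideals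
  \<open>J\<^sub>k = (x\<^sub>i | i < k) + (x\<^sub>j ^ d\<^sub>j | j > k)\<close>. Each \<open>J\<^sub>k\<close> is irreducible, and there are no inclusions
  between them, because \<open>J\<^sub>k\<close> contains powers of all variables except \<open>x\<^sub>k\<close>. So the \<open>J\<^sub>k\<close> are the
  irreducible components, and \<open>I\<^sup>\<or>\<close> is generated by the \<open>n\<close> monomials
  \<open>(\<Prod>i<k. x\<^sub>i) (\<Prod>j>k. x\<^sub>j ^ d\<^sub>j)\<close>.

  On the other side, \<open>x\<^sup>a\<close> lies in \<open>I\<^sup>*\<close> if and only if \<open>a\<^sub>i \<ge> 1\<close> or \<open>a\<^sub>j \<ge> d\<^sub>j\<close> for all \<open>i < j\<close>. That this
  means divisibility by one of the monomials above is the same combinatorial fact about a linear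
  order that produced the components, applied to the complementary conditions on \<open>a\<close>. The lemma
  \<open>acyclic_tournament_cut\<close> states this fact, and it is used for both purposes.

  The algebra behind this is the uniqueness of irredundant irreducible decompositions
  (\<open>irredundant_irreducible_decomp_unique\<close>) and the irreducibility of \<open>J\<^sub>k\<close> among all ideals,
  monomial or not (\<open>irreducible_pure_powers_omitting_one\<close>).
\<close>


section \<open>Products of polynomials and their exponents\<close>

interpretation ideal: module "(*) :: 'a::comm_ring_1 \<Rightarrow> 'a \<Rightarrow> 'a"
  by (rule module_times)

text \<open>
  If \<open>b + c\<close> arises in only one way from the supports of the factors, then nothing is added to, or
  cancelled against, the product of the two corresponding terms.
\<close>
lemma lookup_mult_unique_decomposition:
  fixes f g :: "'a::cancel_comm_monoid_add \<Rightarrow>\<^sub>0 'b::semiring_0"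
  assumes uniq: "\<And>b' c'. b' \<in> Poly_Mapping.keys f \<Longrightarrow> c' \<in> Poly_Mapping.keys g \<Longrightarrow>
    b' + c' = b + c \<Longrightarrow> b' = b"
  shows "Poly_Mapping.lookup (f * g) (b + c) = Poly_Mapping.lookup f b * Poly_Mapping.lookup g c"
proof -
  have inner: "(\<Sum>q. Poly_Mapping.lookup g q when b + c = b + q) = Poly_Mapping.lookup g c"
    by simp
  have "Poly_Mapping.lookup f l * (\<Sum>q. Poly_Mapping.lookup g q when b + c = l + q) =
      (Poly_Mapping.lookup f b * Poly_Mapping.lookup g c when l = b)" for l
  proof (cases "l = b")
    case True
    then show ?thesis using inner by simp
  next
    case False
    have "Poly_Mapping.lookup f l = 0 \<or> (\<forall>q. (Poly_Mapping.lookup g q when b + c = l + q) = 0)"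
      using uniq[of l] False by (metis in_keys_iff when_neq_zero)
    then show ?thesis using False by auto
  qed
  then show ?thesis
    by (simp add: lookup_mult)
qed

lemma monom_add: "monom (a + b) = monom a * monom b"
  by (simp add: monom_def mult_single)

lemma monom_sum: "monom (\<Sum>x\<in>A. g x) = (\<Prod>x\<in>A. monom (g x))"
  by (induction A rule: infinite_finite_induct) (simp_all add: monom_add, simp_all add: monom_def)

lemma keys_monom [simp]: "Poly_Mapping.keys (monom a :: ('v, 'k::comm_ring_1) mpoly) = {a}"
  by (simp add: monom_def)

lemma monom_eq_iff [simp]: "(monom a :: ('v, 'k::comm_ring_1) mpoly) = monom b \<longleftrightarrow> a = b"
  by (metis keys_monom singleton_inject)

lemma var_power: "var v ^ n = monom (Poly_Mapping.single v n)"
proof (induction n)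
  case (Suc n)
  have "Poly_Mapping.single v (Suc n) = Poly_Mapping.single v 1 + Poly_Mapping.single v n"
    by (simp flip: single_add)
  with Suc show ?case by (simp add: var_def monom_add)
qed (simp add: monom_def)

lemma keys_monom_mult:
  fixes p :: "('v, 'k::comm_ring_1) mpoly"
  shows "Poly_Mapping.keys (monom a * p) = (+) a ` Poly_Mapping.keys p"
proof
  show "Poly_Mapping.keys (monom a * p) \<subseteq> (+) a ` Poly_Mapping.keys p"
    using keys_mult[of "monom a" p] by auto
  show "(+) a ` Poly_Mapping.keys p \<subseteq> Poly_Mapping.keys (monom a * p)"
  proof
    fix x assume "x \<in> (+) a ` Poly_Mapping.keys p"
    then obtain c where c: "x = a + c" "c \<in> Poly_Mapping.keys p" by auto
    have "Poly_Mapping.lookup (monom a * p) (a + c) =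
        Poly_Mapping.lookup (monom a :: ('v, 'k) mpoly) a * Poly_Mapping.lookup p c"
      by (rule lookup_mult_unique_decomposition) simp
    with c show "x \<in> Poly_Mapping.keys (monom a * p)"
      by (simp add: in_keys_iff monom_def)
  qed
qed

text \<open>
  Polynomials in the single variable \<open>x\<^sub>k\<close> have no zero divisors: the product of the two terms with
  the largest exponents of \<open>x\<^sub>k\<close> cannot be cancelled.
\<close>
lemma mult_nonzero_one_variable:
  fixes p q :: "('v, 'k::field) mpoly"
  assumes "p \<noteq> 0" "q \<noteq> 0"
    and p: "Poly_Mapping.keys p \<subseteq> range (Poly_Mapping.single k)"
    and q: "Poly_Mapping.keys q \<subseteq> range (Poly_Mapping.single k)"
  shows "p * q \<noteq> 0"
proof -
  let ?m = "\<lambda>a. Poly_Mapping.lookup a k"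
  have lead: "\<exists>b \<in> Poly_Mapping.keys r. \<forall>b' \<in> Poly_Mapping.keys r. ?m b' \<le> ?m b"
    if "r \<noteq> 0" for r :: "('v, 'k) mpoly"
  proof -
    have "Max (?m ` Poly_Mapping.keys r) \<in> ?m ` Poly_Mapping.keys r"
      using that by (intro Max_in) simp_all
    then obtain b where "b \<in> Poly_Mapping.keys r" "?m b = Max (?m ` Poly_Mapping.keys r)"
      by (metis imageE)
    then show ?thesis by (intro bexI[of _ b]) simp_all
  qed
  obtain b where b: "b \<in> Poly_Mapping.keys p" "\<And>b'. b' \<in> Poly_Mapping.keys p \<Longrightarrow> ?m b' \<le> ?m b"
    using lead assms(1) by blast
  obtain c where c: "c \<in> Poly_Mapping.keys q" "\<And>c'. c' \<in> Poly_Mapping.keys q \<Longrightarrow> ?m c' \<le> ?m c"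
    using lead assms(2) by blast
  have "Poly_Mapping.lookup (p * q) (b + c) = Poly_Mapping.lookup p b * Poly_Mapping.lookup q c"
  proof (rule lookup_mult_unique_decomposition)
    fix b' c' assume *: "b' \<in> Poly_Mapping.keys p" "c' \<in> Poly_Mapping.keys q" "b' + c' = b + c"
    have "?m b' + ?m c' = ?m b + ?m c" using *(3) by (metis lookup_add)
    with b(2)[OF *(1)] c(2)[OF *(2)] have "?m b' = ?m b" by linarith
    moreover obtain m n where "b' = Poly_Mapping.single k m" "b = Poly_Mapping.single k n"
      using p b(1) *(1) by blast
    ultimately show "b' = b" by simp
  qed
  also have "\<dots> \<noteq> 0" using b(1) c(1) by (simp add: in_keys_iff)
  finally show ?thesis by (metis lookup_zero)
qed

lemma lookup_sum_single:
  "finite T \<Longrightarrow> Poly_Mapping.lookup (\<Sum>c\<in>T. Poly_Mapping.single c (g c)) x = (g x when x \<in> T)"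
  by (simp add: lookup_sum lookup_single when_def)


section \<open>Monomial ideals as upward closed sets of exponents\<close>

text \<open>
  An ideal generated by monomials consists of all polynomials whose exponents lie in a fixed set
  closed under adding exponents. This turns intersections, sums and inclusions of monomial ideals
  into those of sets.
\<close>
definition supported :: "('v \<Rightarrow>\<^sub>0 nat) set \<Rightarrow> ('v, 'k::comm_ring_1) mpoly set" where
  "supported U = {p. Poly_Mapping.keys p \<subseteq> U}"

definition upset :: "('v \<Rightarrow>\<^sub>0 nat) set \<Rightarrow> bool" where
  "upset U \<longleftrightarrow> (\<forall>a\<in>U. \<forall>t. a + t \<in> U)"

definition multiples :: "('v \<Rightarrow>\<^sub>0 nat) set \<Rightarrow> ('v \<Rightarrow>\<^sub>0 nat) set" where
  "multiples S = {a + t | a t. a \<in> S}"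

lemma exponent_divides_iff:
  fixes a b :: "'v \<Rightarrow>\<^sub>0 nat"
  shows "(\<exists>t. b = a + t) \<longleftrightarrow> (\<forall>v. Poly_Mapping.lookup a v \<le> Poly_Mapping.lookup b v)"
proof
  assume "\<forall>v. Poly_Mapping.lookup a v \<le> Poly_Mapping.lookup b v"
  then have "b = a + (b - a)"
    by (intro poly_mapping_eqI) (simp add: lookup_add lookup_minus)
  then show "\<exists>t. b = a + t" ..
qed (auto simp: lookup_add)

lemma multiples_iff:
  "b \<in> multiples S \<longleftrightarrow> (\<exists>a\<in>S. \<forall>v. Poly_Mapping.lookup a v \<le> Poly_Mapping.lookup b v)"
  unfolding multiples_def exponent_divides_iff[symmetric] by blast

lemma multiples_superset: "S \<subseteq> multiples S"
  by (auto simp: multiples_iff)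

lemma upset_multiples: "upset (multiples S)"
  unfolding upset_def multiples_def by (auto, metis add.assoc)

lemma multiples_upset: "upset U \<Longrightarrow> multiples U = U"
  using multiples_superset[of U] by (auto simp: upset_def multiples_def)

lemma supported_subset_iff [simp]:
  "(supported U :: ('v, 'k::comm_ring_1) mpoly set) \<subseteq> supported V \<longleftrightarrow> U \<subseteq> V"
proof
  assume sub: "(supported U :: ('v, 'k) mpoly set) \<subseteq> supported V"
  show "U \<subseteq> V"
  proof
    fix a assume "a \<in> U"
    then have "(monom a :: ('v, 'k) mpoly) \<in> supported U" by (simp add: supported_def)
    with sub have "(monom a :: ('v, 'k) mpoly) \<in> supported V" by blast
    then show "a \<in> V" by (simp add: supported_def)
  qed
qed (auto simp: supported_def)

lemma supported_eq_iff [simp]: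
  "(supported U :: ('v, 'k::comm_ring_1) mpoly set) = supported V \<longleftrightarrow> U = V"
  using supported_subset_iff by (metis order_antisym order_refl)

lemma supported_Int: "supported U \<inter> supported V = supported (U \<inter> V)"
  by (auto simp: supported_def)

lemma supported_Inter: "(\<Inter>x\<in>X. supported (U x)) = supported (\<Inter>x\<in>X. U x)"
  by (auto simp: supported_def)

lemma is_ideal_supported:
  assumes "upset U"
  shows "is_ideal (supported U :: ('v, 'k::comm_ring_1) mpoly set)"
proof (rule ideal.subspaceI)
  show "(0 :: ('v, 'k) mpoly) \<in> supported U" by (simp add: supported_def)
next
  fix p q :: "('v, 'k) mpoly" assume "p \<in> supported U" "q \<in> supported U"
  then show "p + q \<in> supported U" using keys_add[of p q] by (auto simp: supported_def)
next
  fix c p :: "('v, 'k) mpoly" assume p: "p \<in> supported U"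
  have "x + y \<in> U" if "y \<in> Poly_Mapping.keys p" for x y
  proof -
    have "y \<in> U" using that p by (auto simp: supported_def)
    then show ?thesis using assms by (simp add: upset_def add.commute[of x])
  qed
  then show "c * p \<in> supported U"
    using keys_mult[of c p] by (auto simp: supported_def)
qed

text \<open>
  A polynomial with exponents in \<open>multiples S\<close> is the sum of its terms, and each term is a multiple
  of a generator.
\<close>
lemma ideal_gen_monom:
  "ideal_gen (monom ` S) = (supported (multiples S) :: ('v, 'k::comm_ring_1) mpoly set)"
proof (rule ideal.span_subspace)
  show "monom ` S \<subseteq> (supported (multiples S) :: ('v, 'k) mpoly set)"
    using multiples_superset[of S] by (auto simp: supported_def)
  show "is_ideal (supported (multiples S) :: ('v, 'k) mpoly set)"
    by (intro is_ideal_supported upset_multiples)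
  show "(supported (multiples S) :: ('v, 'k) mpoly set) \<subseteq> ideal_gen (monom ` S)"
  proof
    fix p :: "('v, 'k) mpoly" assume p: "p \<in> supported (multiples S)"
    have term_in: "Poly_Mapping.single c x \<in> ideal_gen (monom ` S)"
      if "c \<in> multiples S" for c and x :: 'k
    proof -
      obtain a t where "a \<in> S" "c = a + t" using \<open>c \<in> multiples S\<close> by (auto simp: multiples_def)
      then have "Poly_Mapping.single c x = Poly_Mapping.single t x * monom a"
        by (simp add: monom_def mult_single add.commute)
      moreover have "(monom a :: ('v, 'k) mpoly) \<in> ideal_gen (monom ` S)"
        using \<open>a \<in> S\<close> by (intro ideal.span_base) simp
      ultimately show ?thesis by (simp only: ideal.span_scale)
    qed
    have "p = (\<Sum>c\<in>Poly_Mapping.keys p. Poly_Mapping.single c (Poly_Mapping.lookup p c))"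
      by (rule poly_mapping_eqI) (simp add: lookup_sum_single when_def in_keys_iff)
    also have "\<dots> \<in> ideal_gen (monom ` S)"
      using p by (intro ideal.span_sum term_in) (auto simp: supported_def)
    finally show "p \<in> ideal_gen (monom ` S)" .
  qed
qed

lemma monomial_ideal_iff: "monomial_ideal I \<longleftrightarrow> (\<exists>U. upset U \<and> I = supported U)"
proof
  assume "monomial_ideal I"
  then obtain T where T: "T \<subseteq> range monom" "I = ideal_gen T"
    unfolding monomial_ideal_def by (elim exE conjE)
  obtain S where "T = monom ` S" using T(1) by (rule subset_imageE)
  with T(2) have "I = supported (multiples S)" by (simp only: ideal_gen_monom)
  with upset_multiples show "\<exists>U. upset U \<and> I = supported U" by (intro exI conjI)
next
  assume "\<exists>U. upset U \<and> I = supported U"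
  then obtain U where U: "upset U" "I = supported U" by (elim exE conjE)
  have "I = ideal_gen (monom ` U)" unfolding U(2) ideal_gen_monom multiples_upset[OF U(1)] ..
  then show "monomial_ideal I"
    unfolding monomial_ideal_def by (intro exI[of _ "monom ` U"] conjI image_mono subset_UNIV)
qed

text \<open>
  If \<open>T\<close> generates the same ideal as the antichain \<open>S\<close>, then every \<open>s\<close> in \<open>S\<close> is divisible by some
  \<open>t\<close> in \<open>T\<close>, which in turn is divisible by some \<open>s'\<close> in \<open>S\<close>. The antichain condition forces
  \<open>s' = s\<close>, hence \<open>t = s\<close>. So every monomial generating set contains \<open>S\<close>, which gives both the
  minimality of \<open>S\<close> and its uniqueness.
\<close>
lemma min_gens_antichain:
  assumes anti: "\<And>a b. a \<in> S \<Longrightarrow> b \<in> S \<Longrightarrow>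
    (\<And>v. Poly_Mapping.lookup a v \<le> Poly_Mapping.lookup b v) \<Longrightarrow> a = b"
  shows "min_gens (supported (multiples S) :: ('v, 'k::comm_ring_1) mpoly set) = monom ` S"
proof -
  let ?I = "supported (multiples S) :: ('v, 'k) mpoly set"
  have contains: "S \<subseteq> T" if eq: "multiples T = multiples S" for T
  proof
    fix s assume s: "s \<in> S"
    then have "s \<in> multiples T" using eq multiples_superset[of S] by blast
    then obtain t where t: "t \<in> T" "\<And>v. Poly_Mapping.lookup t v \<le> Poly_Mapping.lookup s v"
      unfolding multiples_iff by blast
    then have "t \<in> multiples S" using eq multiples_superset[of T] by blast
    then obtain s' where s': "s' \<in> S" "\<And>v. Poly_Mapping.lookup s' v \<le> Poly_Mapping.lookup t v"
      unfolding multiples_iff by blast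
    have "s' = s" using s s' t by (intro anti) (auto intro: order_trans)
    then have "t = s" using s'(2) t(2) by (intro poly_mapping_eqI) (simp add: order_antisym)
    with t show "s \<in> T" by simp
  qed
  have minimal: "ideal_gen T \<noteq> ?I" if "T \<subset> monom ` S" for T
  proof
    assume "ideal_gen T = ?I"
    moreover obtain T' where T': "T = monom ` T'" "T' \<subseteq> S"
      using \<open>T \<subset> monom ` S\<close> by (metis psubset_imp_subset subset_imageE)
    ultimately have "S \<subseteq> T'" using contains by (simp add: ideal_gen_monom)
    with T' that show False by auto
  qed
  show ?thesis
    unfolding min_gens_def
  proof (rule the_equality)
    show "monom ` S \<subseteq> range monom \<and> ideal_gen (monom ` S) = ?I \<and>
        (\<forall>T. T \<subset> monom ` S \<longrightarrow> ideal_gen T \<noteq> ?I)"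
      using minimal by (auto simp: ideal_gen_monom)
  next
    fix T assume T: "T \<subseteq> range monom \<and> ideal_gen T = ?I \<and> (\<forall>T'. T' \<subset> T \<longrightarrow> ideal_gen T' \<noteq> ?I)"
    then obtain T' where T': "T = monom ` T'" by (metis subset_imageE)
    with T have "S \<subseteq> T'" using contains by (simp add: ideal_gen_monom)
    then have "monom ` S \<subseteq> T" using T' by blast
    moreover have "\<not> monom ` S \<subset> T" using T ideal_gen_monom by meson
    ultimately show "T = monom ` S" by blast
  qed
qed


section \<open>Uniqueness of irredundant irreducible decompositions\<close>

text \<open>
  Sum and intersection of monomial ideals distribute over each other, so
  \<open>J = J + (A \<inter> B) = (J + A) \<inter> (J + B)\<close>, and irreducibility makes one of the two factors equal to \<open>J\<close>.
\<close>
lemma irreducible_ideal_contains_intersection: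
  fixes J A B :: "('v, 'k::comm_ring_1) mpoly set"
  assumes "irreducible_ideal J" "monomial_ideal J" "monomial_ideal A" "monomial_ideal B"
    and sub: "A \<inter> B \<subseteq> J"
  shows "A \<subseteq> J \<or> B \<subseteq> J"
proof -
  obtain U V W where up: "upset U" "upset V" "upset W"
    and eq: "J = supported U" "A = supported V" "B = supported W"
    using assms(2-4) by (auto simp: monomial_ideal_iff)
  have VW: "V \<inter> W \<subseteq> U"
    using sub by (simp add: eq supported_Int)
  let ?J1 = "supported (U \<union> V) :: ('v, 'k) mpoly set" and ?J2 = "supported (U \<union> W) :: ('v, 'k) mpoly set"
  have "upset (U \<union> V)" "upset (U \<union> W)" using up by (auto simp: upset_def)
  then have "is_ideal ?J1" "is_ideal ?J2" by (simp_all add: is_ideal_supported)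
  moreover have "J = ?J1 \<inter> ?J2"
    using VW by (simp add: eq supported_Int) blast
  moreover have "J \<subseteq> ?J1" "J \<subseteq> ?J2" by (simp_all add: eq)
  ultimately have "\<not> (J \<subset> ?J1 \<and> J \<subset> ?J2)"
    using assms(1) unfolding irreducible_ideal_def by blast
  with \<open>J \<subseteq> ?J1\<close> \<open>J \<subseteq> ?J2\<close> have "J = ?J1 \<or> J = ?J2" by blast
  then show ?thesis by (auto simp: eq)
qed

lemma monomial_ideal_Inter:
  assumes "\<forall>A\<in>F. monomial_ideal A"
  shows "monomial_ideal (\<Inter>F)"
proof -
  obtain U where up: "\<And>A. A \<in> F \<Longrightarrow> upset (U A)" and U: "\<And>A. A \<in> F \<Longrightarrow> A = supported (U A)"
    using assms unfolding monomial_ideal_iff by metis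
  have "\<Inter>F = (\<Inter>A\<in>F. A)" by simp
  also have "\<dots> = (\<Inter>A\<in>F. supported (U A))" by (intro INF_cong refl U)
  also have "\<dots> = supported (\<Inter>A\<in>F. U A)" by (rule supported_Inter)
  finally have eq: "\<Inter>F = supported (\<Inter>A\<in>F. U A)" .
  have "upset (\<Inter>A\<in>F. U A)" using up by (simp add: upset_def)
  then show ?thesis unfolding monomial_ideal_iff eq by blast
qed

lemma irreducible_ideal_contains_Inter:
  fixes J :: "('v, 'k::comm_ring_1) mpoly set"
  assumes J: "irreducible_ideal J" "monomial_ideal J"
    and "finite F" "\<forall>A\<in>F. monomial_ideal A" "\<Inter>F \<subseteq> J"
  shows "\<exists>A\<in>F. A \<subseteq> J"
  using assms(3-)
proof (induction F rule: finite_induct)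
  case empty
  then show ?case using J(1) by (auto simp: irreducible_ideal_def)
next
  case (insert A F)
  then have "A \<subseteq> J \<or> \<Inter>F \<subseteq> J"
    by (intro irreducible_ideal_contains_intersection[OF J] monomial_ideal_Inter) auto
  with insert show ?case by auto
qed

lemma irredundant_irreducible_decomp_antichain:
  assumes "irredundant_irreducible_decomp I C" "J \<in> C" "L \<in> C" "L \<subseteq> J"
  shows "L = J"
proof (rule ccontr)
  assume "L \<noteq> J"
  then have "\<Inter>(C - {J}) = \<Inter>C" using assms by auto
  with assms show False by (auto simp: irredundant_irreducible_decomp_def)
qed

text \<open>
  A component \<open>J\<close> of one decomposition contains a component \<open>L\<close> of the other, which contains a
  component \<open>J'\<close> of the first. Irredundance gives \<open>J' = J\<close>, and with it \<open>L = J\<close>.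
\<close>
lemma irredundant_irreducible_decomp_unique:
  fixes I :: "('v, 'k::comm_ring_1) mpoly set"
  assumes "irredundant_irreducible_decomp I C" "irredundant_irreducible_decomp I D"
  shows "C = D"
proof -
  have "C \<subseteq> D" if C: "irredundant_irreducible_decomp I C" and D: "irredundant_irreducible_decomp I D"
    for C D :: "('v, 'k) mpoly set set"
  proof
    fix J assume J: "J \<in> C"
    have "\<exists>L\<in>D. L \<subseteq> J"
      using C D J
      by (intro irreducible_ideal_contains_Inter)
        (auto simp: irredundant_irreducible_decomp_def)
    then obtain L where L: "L \<in> D" "L \<subseteq> J" by blast
    have "\<exists>J'\<in>C. J' \<subseteq> L"
      using C D L(1)
      by (intro irreducible_ideal_contains_Inter)
        (auto simp: irredundant_irreducible_decomp_def)
    then obtain J' where J': "J' \<in> C" "J' \<subseteq> L" by blast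
    have "J' = J" using irredundant_irreducible_decomp_antichain[OF C J J'(1)] J' L by blast
    with J' L show "J \<in> D" by auto
  qed
  with assms show ?thesis by blast
qed

lemma irreducible_components_eqI:
  fixes C :: "('v, 'k::comm_ring_1) mpoly set set"
  assumes "finite C" and irr: "\<And>J. J \<in> C \<Longrightarrow> monomial_ideal J \<and> irreducible_ideal J"
    and anti: "\<And>J L. J \<in> C \<Longrightarrow> L \<in> C \<Longrightarrow> L \<subseteq> J \<Longrightarrow> L = J"
  shows "irreducible_components (\<Inter>C) = C"
proof -
  have "\<Inter>C \<noteq> \<Inter>(C - {J})" if J: "J \<in> C" for J
  proof
    assume "\<Inter>C = \<Inter>(C - {J})"
    then have "\<Inter>(C - {J}) \<subseteq> J" using J by blast
    then have "\<exists>L\<in>C - {J}. L \<subseteq> J"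
      using assms(1) irr J by (intro irreducible_ideal_contains_Inter) auto
    with J anti show False by blast
  qed
  with assms have decomp: "irredundant_irreducible_decomp (\<Inter>C) C"
    by (simp add: irredundant_irreducible_decomp_def)
  show ?thesis
    unfolding irreducible_components_def
    by (rule the_equality[of "irredundant_irreducible_decomp (\<Inter>C)", OF decomp])
      (rule irredundant_irreducible_decomp_unique[OF _ decomp])
qed


section \<open>Ideals generated by powers of variables\<close>

definition pure_powers :: "'v set \<Rightarrow> ('v \<Rightarrow> nat) \<Rightarrow> ('v \<Rightarrow>\<^sub>0 nat) set" where
  "pure_powers S e = (\<lambda>v. Poly_Mapping.single v (e v)) ` S"

lemma multiples_pure_powers:
  "b \<in> multiples (pure_powers S e) \<longleftrightarrow> (\<exists>v\<in>S. e v \<le> Poly_Mapping.lookup b v)"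
proof -
  have "(\<forall>u. Poly_Mapping.lookup (Poly_Mapping.single v (e v)) u \<le> Poly_Mapping.lookup b u) \<longleftrightarrow>
      e v \<le> Poly_Mapping.lookup b v" for v
    by (auto simp: lookup_single when_def)
  then show ?thesis by (auto simp: multiples_iff pure_powers_def)
qed

lemma min_gens_pure_powers:
  assumes pos: "\<And>v. v \<in> S \<Longrightarrow> e v \<ge> 1"
  shows "min_gens (supported (multiples (pure_powers S e)) :: ('v, 'k::comm_ring_1) mpoly set) =
    monom ` pure_powers S e"
proof (rule min_gens_antichain)
  fix a b
  assume "a \<in> pure_powers S e" "b \<in> pure_powers S e"
    and le: "\<And>v. Poly_Mapping.lookup a v \<le> Poly_Mapping.lookup b v"
  then obtain u v where uv: "u \<in> S" "v \<in> S"
      "a = Poly_Mapping.single u (e u)" "b = Poly_Mapping.single v (e v)"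
    by (auto simp: pure_powers_def)
  with le[of u] pos[of u] have "u = v" by (auto simp: lookup_single when_def split: if_splits)
  with uv show "a = b" by simp
qed

lemma prod_min_gens_pure_powers:
  fixes S :: "'v::finite set"
  assumes pos: "\<And>v. v \<in> S \<Longrightarrow> e v \<ge> 1"
  shows "(\<Prod>f\<in>min_gens (supported (multiples (pure_powers S e))). f) =
    (monom (\<Sum>v\<in>S. Poly_Mapping.single v (e v)) :: ('v, 'k::comm_ring_1) mpoly)"
proof -
  have inj: "inj_on (\<lambda>v. monom (Poly_Mapping.single v (e v)) :: ('v, 'k) mpoly) S"
  proof (rule inj_onI)
    fix u v assume uv: "u \<in> S" "v \<in> S"
      "(monom (Poly_Mapping.single u (e u)) :: ('v, 'k) mpoly) = monom (Poly_Mapping.single v (e v))"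
    then have "e u = Poly_Mapping.lookup (Poly_Mapping.single v (e v)) u"
      by (metis monom_eq_iff lookup_single_eq)
    then show "u = v" using pos[OF uv(1)] by (metis lookup_single_not_eq not_one_le_zero)
  qed
  have gens: "min_gens (supported (multiples (pure_powers S e)) :: ('v, 'k) mpoly set) =
      monom ` pure_powers S e"
    by (rule min_gens_pure_powers) (rule pos)
  have "(\<Prod>f\<in>min_gens (supported (multiples (pure_powers S e)) :: ('v, 'k) mpoly set). f) =
      (\<Prod>f\<in>(\<lambda>v. monom (Poly_Mapping.single v (e v))) ` S. f)"
    unfolding gens by (simp add: pure_powers_def image_image)
  also have "\<dots> = (\<Prod>v\<in>S. monom (Poly_Mapping.single v (e v)))"
    using inj by (simp add: prod.reindex)
  finally show ?thesis by (simp add: monom_sum)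
qed

text \<open>
  Let \<open>J\<close> be generated by the powers \<open>x\<^sub>v ^ e\<^sub>v\<close> for \<open>v \<noteq> k\<close>, and let \<open>x\<^sup>w\<close> be the product of the
  \<open>x\<^sub>v ^ (e\<^sub>v - 1)\<close>. The residue ring modulo \<open>J\<close> is a free \<open>K[x\<^sub>k]\<close>-module, and \<open>x\<^sup>w\<close> spans the part
  that is annihilated by all other variables. Every ideal properly containing \<open>J\<close> meets this part:
  it contains \<open>x\<^sup>w p\<close> for some nonzero \<open>p\<close> in \<open>K[x\<^sub>k]\<close>. If \<open>x\<^sup>w p\<close> lies in one such ideal and \<open>x\<^sup>w q\<close>
  in another, then \<open>x\<^sup>w p q\<close> lies in both, but not in \<open>J\<close>. So \<open>J\<close> is not their intersection.
\<close>
lemma irreducible_pure_powers_omitting_one: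
  fixes k :: "'v::finite"
  assumes pos: "\<And>v. v \<noteq> k \<Longrightarrow> e v \<ge> 1"
  shows "irreducible_ideal (supported (multiples (pure_powers (- {k}) e)) :: ('v, 'k::field) mpoly set)"
proof -
  define U where "U = multiples (pure_powers (- {k}) e)"
  define J where "J = (supported U :: ('v, 'k) mpoly set)"
  have U_iff: "a \<in> U \<longleftrightarrow> (\<exists>v. v \<noteq> k \<and> e v \<le> Poly_Mapping.lookup a v)" for a
    by (auto simp: U_def multiples_pure_powers)
  have up: "upset U" by (simp add: U_def upset_multiples)
  have ideal: "is_ideal J" by (simp add: J_def is_ideal_supported up)
  have "(0 :: 'v \<Rightarrow>\<^sub>0 nat) \<notin> U" using pos by (force simp: U_iff)
  then have "(monom 0 :: ('v, 'k) mpoly) \<notin> J" by (simp add: J_def supported_def)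
  then have proper: "J \<noteq> UNIV" by blast

  define w where "w = (\<Sum>v\<in>- {k}. Poly_Mapping.single v (e v - 1))"
  have w: "Poly_Mapping.lookup w v = (if v = k then 0 else e v - 1)" for v
    by (simp add: w_def lookup_sum_single when_def)
  have w_notin: "w + Poly_Mapping.single k n \<notin> U" for n
    using pos by (force simp: U_iff lookup_add w lookup_single when_def)

  have socle: "\<exists>t p j. monom t * f = monom w * p + j \<and> j \<in> J \<and> p \<noteq> 0 \<and>
      Poly_Mapping.keys p \<subseteq> range (Poly_Mapping.single k)" if f: "f \<notin> J" for f :: "('v, 'k) mpoly"
  proof -
    (* Among the terms of f outside J, the term b has the least degree in the variables other than
       k. Multiplication by t = w - b takes b to w up to a power of x_k; any other term of f is moved
       into J unless its exponents away from k are at most those of b, hence equal to them by the choice of b. *)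
    define deg where "deg c = (\<Sum>v\<in>- {k}. Poly_Mapping.lookup c v)" for c :: "'v \<Rightarrow>\<^sub>0 nat"
    have "Poly_Mapping.keys f - U \<noteq> {}" using f by (auto simp: J_def supported_def)
    then obtain b0 where "b0 \<in> Poly_Mapping.keys f - U" by blast
    then obtain b where b: "b \<in> Poly_Mapping.keys f - U"
      and b_min: "\<And>c. c \<in> Poly_Mapping.keys f - U \<Longrightarrow> deg b \<le> deg c"
      using ex_has_least_nat[of "\<lambda>c. c \<in> Poly_Mapping.keys f - U" b0 deg] by blast
    have b_lt: "Poly_Mapping.lookup b v \<le> e v - 1" if "v \<noteq> k" for v
      using b that pos[of v] by (auto simp: U_iff not_le dest!: spec[of _ v])
    define t where "t = w - b"
    have t: "Poly_Mapping.lookup t v = (if v = k then 0 else e v - 1 - Poly_Mapping.lookup b v)" for v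
      by (simp add: t_def lookup_minus w)
    define h where "h = monom t * f"
    define T where "T = Poly_Mapping.keys h - U"
    have T: "c \<in> range (\<lambda>n. w + Poly_Mapping.single k n)" if "c \<in> T" for c
    proof -
      obtain c0 where c0: "c = t + c0" "c0 \<in> Poly_Mapping.keys f"
        using \<open>c \<in> T\<close> by (auto simp: T_def h_def keys_monom_mult)
      have "c0 \<notin> U" using up c0(1) \<open>c \<in> T\<close> by (metis T_def DiffD2 add.commute upset_def)
      have le: "Poly_Mapping.lookup c0 v \<le> Poly_Mapping.lookup b v" if "v \<noteq> k" for v
      proof -
        have "\<not> e v \<le> Poly_Mapping.lookup c v" using \<open>c \<in> T\<close> that by (auto simp: T_def U_iff)
        with that b_lt[OF that] show ?thesis by (simp add: c0 lookup_add t)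
      qed
      have "Poly_Mapping.lookup c0 v = Poly_Mapping.lookup b v" if "v \<noteq> k" for v
      proof (rule ccontr)
        assume "Poly_Mapping.lookup c0 v \<noteq> Poly_Mapping.lookup b v"
        then have "deg c0 < deg b"
          unfolding deg_def using le that
          by (intro sum_strict_mono_ex1) (auto intro!: bexI[of _ v] simp: order_less_le)
        with b_min c0 \<open>c0 \<notin> U\<close> show False by (meson DiffI not_le)
      qed
      with b_lt have "Poly_Mapping.lookup c v =
          Poly_Mapping.lookup (w + Poly_Mapping.single k (Poly_Mapping.lookup c0 k)) v" for v
        by (cases "v = k") (simp_all add: c0 lookup_add t w lookup_single when_def del: diff_diff_left)
      then have "c = w + Poly_Mapping.single k (Poly_Mapping.lookup c0 k)"
        by (rule poly_mapping_eqI)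
      then show ?thesis by blast
    qed
    have "Poly_Mapping.lookup (t + b) v =
        Poly_Mapping.lookup (w + Poly_Mapping.single k (Poly_Mapping.lookup b k)) v" for v
      using b_lt
      by (cases "v = k") (simp_all add: lookup_add t w lookup_single when_def del: diff_diff_left)
    then have "t + b = w + Poly_Mapping.single k (Poly_Mapping.lookup b k)"
      by (rule poly_mapping_eqI)
    then have "t + b \<notin> U" by (simp add: w_notin)
    moreover have "t + b \<in> (+) t ` Poly_Mapping.keys f" using b by blast
    ultimately have b_T: "t + b \<in> T" by (simp add: T_def h_def keys_monom_mult)
    have "finite T" by (simp add: T_def)
    define p where "p = (\<Sum>c\<in>T. Poly_Mapping.single (c - w) (Poly_Mapping.lookup h c))"
    have "w + (c - w) = c" if "c \<in> T" for c using T[OF that] by auto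
    then have "monom w * p = (\<Sum>c\<in>T. Poly_Mapping.single c (Poly_Mapping.lookup h c))"
      unfolding p_def sum_distrib_left
      by (intro sum.cong) (simp_all add: monom_def mult_single)
    then have lookup_wp: "Poly_Mapping.lookup (monom w * p) c = (Poly_Mapping.lookup h c when c \<in> T)" for c
      using \<open>finite T\<close> by (simp add: lookup_sum_single)
    have "Poly_Mapping.lookup (monom w * p) (t + b) \<noteq> 0"
      using b_T by (simp add: lookup_wp) (simp add: T_def in_keys_iff)
    then have "p \<noteq> 0" by auto
    moreover have "Poly_Mapping.keys p \<subseteq> range (Poly_Mapping.single k)"
    proof -
      have "Poly_Mapping.keys p \<subseteq> (\<Union>c\<in>T. {c - w})"
        unfolding p_def by (rule order_trans[OF keys_sum]) (auto split: if_splits)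
      moreover have "c - w \<in> range (Poly_Mapping.single k)" if "c \<in> T" for c using T[OF that] by auto
      ultimately show ?thesis by blast
    qed
    moreover have "h - monom w * p \<in> J"
    proof -
      have "c \<in> U" if "Poly_Mapping.lookup (h - monom w * p) c \<noteq> 0" for c
        using that by (auto simp: lookup_minus lookup_wp T_def in_keys_iff when_def split: if_splits)
      then show ?thesis by (auto simp: J_def supported_def in_keys_iff)
    qed
    ultimately show ?thesis
      by (intro exI[of _ t] exI[of _ p] exI[of _ "h - monom w * p"]) (simp add: h_def)
  qed

  have multiplier_in: "r * (monom w * p) \<in> A"
    if A: "is_ideal A" "J \<subset> A" "f \<in> A" and p: "monom t * f = monom w * p + j" "j \<in> J"
    for A f t p j r
  proof -
    have "monom t * f - j \<in> A"
      using ideal.subspace_diff[OF A(1)] ideal.subspace_scale[OF A(1) A(3)] A(2) p(2) by blast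
    then have "monom w * p \<in> A" by (simp add: p(1))
    then show ?thesis by (rule ideal.subspace_scale[OF A(1)])
  qed

  have False if A: "is_ideal A" "J \<subset> A" and B: "is_ideal B" "J \<subset> B" and AB: "J = A \<inter> B" for A B
  proof -
    obtain f g where f: "f \<in> A" "f \<notin> J" and g: "g \<in> B" "g \<notin> J" using A B by blast
    obtain t p j where p: "monom t * f = monom w * p + j" "j \<in> J" "p \<noteq> 0"
        "Poly_Mapping.keys p \<subseteq> range (Poly_Mapping.single k)"
      using socle[OF f(2)] by blast
    obtain t' q j' where q: "monom t' * g = monom w * q + j'" "j' \<in> J" "q \<noteq> 0"
        "Poly_Mapping.keys q \<subseteq> range (Poly_Mapping.single k)"
      using socle[OF g(2)] by blast
    have "q * (monom w * p) \<in> A" using multiplier_in[OF A f(1) p(1,2)] .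
    moreover have "p * (monom w * q) \<in> B" using multiplier_in[OF B g(1) q(1,2)] .
    moreover have "q * (monom w * p) = monom w * (p * q)" "p * (monom w * q) = monom w * (p * q)"
      by (simp_all only: mult_ac)
    ultimately have "monom w * (p * q) \<in> J" by (simp only: AB Int_iff)
    then have in_U: "(+) w ` Poly_Mapping.keys (p * q) \<subseteq> U"
      by (simp only: J_def supported_def mem_Collect_eq keys_monom_mult)
    have "p * q \<noteq> 0" using p q by (intro mult_nonzero_one_variable)
    then obtain c where c: "c \<in> Poly_Mapping.keys (p * q)" by fastforce
    then obtain a b where ab: "c = a + b" "a \<in> Poly_Mapping.keys p" "b \<in> Poly_Mapping.keys q"
      using keys_mult[of p q] by blast
    obtain m n where "a = Poly_Mapping.single k m" "b = Poly_Mapping.single k n"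
      using ab(2,3) p(4) q(4) by blast
    then have "c = Poly_Mapping.single k (m + n)" by (simp add: ab(1) single_add)
    with c in_U w_notin show False by blast
  qed
  with ideal proper show ?thesis
    unfolding irreducible_ideal_def J_def[symmetric] U_def[symmetric] by blast
qed


section \<open>Edge ideals of acyclic tournaments\<close>

text \<open>
  In the linear order: \<open>P i\<close> or \<open>Q j\<close> holds for all \<open>i < j\<close> if and only if there is a cut \<open>k\<close> with \<open>P\<close>
  everywhere below and \<open>Q\<close> everywhere above it. The cut is the first vertex where \<open>P\<close> fails, or the
  last vertex if \<open>P\<close> never fails. Conversely, if \<open>P u\<close> and \<open>Q v\<close> both failed for an arrow
  \<open>u \<rightarrow> v\<close>, then \<open>v \<le> k \<le> u\<close> would close a cycle.
\<close>
lemma acyclic_tournament_cut: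
  fixes E :: "'v::finite rel"
  assumes "tournament E" "acyclic E"
  shows "(\<forall>(u, v)\<in>E. P u \<or> Q v) \<longleftrightarrow> (\<exists>k. \<forall>v. v \<noteq> k \<longrightarrow> (if (v, k) \<in> E then P v else Q v))"
proof
  have total: "(v, k) \<notin> E \<Longrightarrow> v \<noteq> k \<Longrightarrow> (k, v) \<in> E" for k v
    using assms(1) by (auto simp: tournament_def total_on_def)
  assume L: "\<forall>(u, v)\<in>E. P u \<or> Q v"
  show "\<exists>k. \<forall>v. v \<noteq> k \<longrightarrow> (if (v, k) \<in> E then P v else Q v)"
  proof (cases "\<exists>k. \<not> P k")
    case True
    have "wf E" using assms(2) by (intro finite_acyclic_wf) simp_all
    then obtain k where "\<not> P k" "\<And>u. (u, k) \<in> E \<Longrightarrow> P u"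
      using True wfE_min[of E _ "{k. \<not> P k}"] by (metis mem_Collect_eq)
    with L total show ?thesis by (intro exI[of _ k]) fastforce
  next
    case False
    have "wf (E\<inverse>)" using assms(2) by (intro finite_acyclic_wf) simp_all
    then obtain k where "\<And>v. (k, v) \<notin> E"
      using wfE_min[of "E\<inverse>" _ UNIV] by (metis UNIV_I converse_iff)
    with False total show ?thesis by (intro exI[of _ k]) metis
  qed
next
  assume "\<exists>k. \<forall>v. v \<noteq> k \<longrightarrow> (if (v, k) \<in> E then P v else Q v)"
  then obtain k where k: "\<And>v. v \<noteq> k \<Longrightarrow> if (v, k) \<in> E then P v else Q v" by blast
  have "P u \<or> Q v" if uv: "(u, v) \<in> E" for u v
  proof (rule ccontr)
    assume *: "\<not> (P u \<or> Q v)"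
    have "u = k \<or> (u, k) \<notin> E" using k[of u] * by auto
    then have "u = k \<or> (k, u) \<in> E"
      using assms(1) by (auto simp: tournament_def total_on_def)
    moreover have "v = k \<or> (v, k) \<in> E" using k[of v] * by metis
    ultimately have "(u, u) \<in> E\<^sup>+" using uv by (meson trancl.simps trancl_trans)
    with assms(2) show False by (simp add: acyclic_def)
  qed
  then show "\<forall>(u, v)\<in>E. P u \<or> Q v" by blast
qed

definition edge_exponent :: "('v \<Rightarrow> nat) \<Rightarrow> 'v \<Rightarrow> 'v \<Rightarrow> 'v \<Rightarrow>\<^sub>0 nat" where
  "edge_exponent d u v = Poly_Mapping.single u 1 + Poly_Mapping.single v (d v)"

definition edge_exponents :: "'v rel \<Rightarrow> ('v \<Rightarrow> nat) \<Rightarrow> ('v \<Rightarrow>\<^sub>0 nat) set" where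
  "edge_exponents E d = {edge_exponent d u v | u v. (u, v) \<in> E}"

lemma lookup_edge_exponent:
  "u \<noteq> v \<Longrightarrow> Poly_Mapping.lookup (edge_exponent d u v) x =
    (if x = u then 1 else if x = v then d v else 0)"
  by (simp add: edge_exponent_def lookup_add lookup_single when_def)

lemma edge_ideal_supported:
  "edge_ideal E d = (supported (multiples (edge_exponents E d)) :: ('v, 'k::comm_ring_1) mpoly set)"
proof -
  have "var u * var v ^ d v = (monom (edge_exponent d u v) :: ('v, 'k) mpoly)" for u v
    by (simp add: edge_exponent_def var_power monom_add) (simp add: var_def)
  then have "{var u * var v ^ d v | u v. (u, v) \<in> E} =
      (monom ` edge_exponents E d :: ('v, 'k) mpoly set)"
    unfolding edge_exponents_def by (simp only:) blast
  then show ?thesis by (simp add: edge_ideal_def ideal_gen_monom)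
qed

lemma min_gens_edge_ideal:
  assumes E: "asym E" and d: "\<And>v. d v \<ge> 1"
  shows "min_gens (edge_ideal E d :: ('v, 'k::comm_ring_1) mpoly set) = monom ` edge_exponents E d"
  unfolding edge_ideal_supported
proof (rule min_gens_antichain)
  fix a b
  assume "a \<in> edge_exponents E d" "b \<in> edge_exponents E d"
    and le: "\<And>v. Poly_Mapping.lookup a v \<le> Poly_Mapping.lookup b v"
  then obtain u v u' v' where
      a: "(u, v) \<in> E" "a = edge_exponent d u v" and
      b: "(u', v') \<in> E" "b = edge_exponent d u' v'"
    by (auto simp: edge_exponents_def)
  have ne: "u \<noteq> v" "u' \<noteq> v'" using a(1) b(1) asymD[OF E] by blast+
  have "u \<in> {u', v'}" "v \<in> {u', v'}"
    using le[of u] le[of v] ne d[of v]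
    by (auto simp: a b lookup_edge_exponent[OF ne(1)] lookup_edge_exponent[OF ne(2)] split: if_splits)
  then have "u = u' \<and> v = v'" using ne(1) a(1) b(1) asymD[OF E] by blast
  then show "a = b" by (simp add: a b)
qed

text \<open>
  The exponents in the component \<open>(x\<^sub>i | i < k) + (x\<^sub>j ^ d\<^sub>j | j > k)\<close>, where \<open>(v, k) \<in> E\<close> says that \<open>v\<close>
  precedes \<open>k\<close>.
\<close>
definition component_exponents :: "'v rel \<Rightarrow> ('v \<Rightarrow> nat) \<Rightarrow> 'v \<Rightarrow> 'v \<Rightarrow> nat" where
  "component_exponents E d k v = (if (v, k) \<in> E then 1 else d v)"

definition component :: "'v rel \<Rightarrow> ('v \<Rightarrow> nat) \<Rightarrow> 'v \<Rightarrow> ('v, 'k::comm_ring_1) mpoly set" where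
  "component E d k = supported (multiples (pure_powers (- {k}) (component_exponents E d k)))"

lemma component_exponents_pos: "d v \<ge> 1 \<Longrightarrow> component_exponents E d k v \<ge> 1"
  by (simp add: component_exponents_def)

lemma component_exponents_le_iff:
  "component_exponents E d k v \<le> Poly_Mapping.lookup a v \<longleftrightarrow>
    (if (v, k) \<in> E then 1 \<le> Poly_Mapping.lookup a v else d v \<le> Poly_Mapping.lookup a v)"
  by (simp add: component_exponents_def)

text \<open>
  The cut lemma, applied to the conditions \<open>a\<^sub>i = 0\<close> and \<open>a\<^sub>j < d\<^sub>j\<close>, which describe the monomials
  outside the edge ideal.
\<close>
lemma edge_ideal_Inter_components:
  fixes E :: "'v::finite rel"
  assumes E: "tournament E" "acyclic E"
  shows "edge_ideal E d = (\<Inter>k. component E d k :: ('v, 'k::comm_ring_1) mpoly set)"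
proof -
  have asym: "asym E" using E by (simp add: tournament_def oriented_graph_def)
  have "a \<in> multiples (edge_exponents E d) \<longleftrightarrow>
      (\<forall>k. a \<in> multiples (pure_powers (- {k}) (component_exponents E d k)))" for a
  proof -
    have "(\<forall>x. Poly_Mapping.lookup (edge_exponent d u v) x \<le> Poly_Mapping.lookup a x) \<longleftrightarrow>
        1 \<le> Poly_Mapping.lookup a u \<and> d v \<le> Poly_Mapping.lookup a v"
      if "(u, v) \<in> E" for u v
    proof -
      have ne: "u \<noteq> v" using that asym by (auto dest: asymD)
      have "(\<forall>x. Poly_Mapping.lookup (edge_exponent d u v) x \<le> Poly_Mapping.lookup a x) \<longleftrightarrow>
          (\<forall>x\<in>{u, v}. Poly_Mapping.lookup (edge_exponent d u v) x \<le> Poly_Mapping.lookup a x)"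
        by (auto simp: lookup_edge_exponent[OF ne])
      then show ?thesis using ne by (simp add: lookup_edge_exponent[OF ne])
    qed
    then have "a \<in> multiples (edge_exponents E d) \<longleftrightarrow>
        (\<exists>(u, v)\<in>E. 1 \<le> Poly_Mapping.lookup a u \<and> d v \<le> Poly_Mapping.lookup a v)"
      by (force simp: multiples_iff edge_exponents_def)
    also have "\<dots> \<longleftrightarrow> \<not> (\<forall>(u, v)\<in>E. \<not> 1 \<le> Poly_Mapping.lookup a u \<or> \<not> d v \<le> Poly_Mapping.lookup a v)"
      by auto
    also have "\<dots> \<longleftrightarrow> \<not> (\<exists>k. \<forall>v. v \<noteq> k \<longrightarrow>
        (if (v, k) \<in> E then \<not> 1 \<le> Poly_Mapping.lookup a v else \<not> d v \<le> Poly_Mapping.lookup a v))"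
      by (subst acyclic_tournament_cut[OF E]) (rule refl)
    also have "\<dots> \<longleftrightarrow> (\<forall>k. a \<in> multiples (pure_powers (- {k}) (component_exponents E d k)))"
      unfolding multiples_pure_powers component_exponents_le_iff Bex_def by auto
    finally show ?thesis .
  qed
  then have "multiples (edge_exponents E d) =
      (\<Inter>k. multiples (pure_powers (- {k}) (component_exponents E d k)))"
    by (intro set_eqI) simp
  then show ?thesis
    by (simp add: edge_ideal_supported component_def supported_Inter)
qed

text \<open>
  There are no inclusions between the components: the one for \<open>l\<close> contains a power of \<open>x\<^sub>k\<close> whenever
  \<open>k \<noteq> l\<close>, whereas the one for \<open>k\<close> contains none.
\<close>
lemma irreducible_components_edge_ideal:
  fixes E :: "'v::finite rel"
  assumes E: "tournament E" "acyclic E" and d: "\<And>v. d v \<ge> 1"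
  shows "irreducible_components (edge_ideal E d :: ('v, 'k::field) mpoly set) = range (component E d)"
  unfolding edge_ideal_Inter_components[OF E]
proof (rule irreducible_components_eqI)
  show "finite (range (component E d) :: ('v, 'k) mpoly set set)" by simp
next
  fix J :: "('v, 'k) mpoly set" assume "J \<in> range (component E d)"
  then obtain k where J: "J = component E d k" by auto
  have "irreducible_ideal J"
    unfolding J component_def
    by (intro irreducible_pure_powers_omitting_one component_exponents_pos d)
  moreover have "monomial_ideal J"
    unfolding J component_def monomial_ideal_iff using upset_multiples by metis
  ultimately show "monomial_ideal J \<and> irreducible_ideal J" by blast
next
  fix J L :: "('v, 'k) mpoly set"
  assume "J \<in> range (component E d)" "L \<in> range (component E d)" and sub: "L \<subseteq> J"
  then obtain k l where kl: "J = component E d k" "L = component E d l" by auto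
  have "k = l"
  proof (rule ccontr)
    assume "k \<noteq> l"
    let ?c = "Poly_Mapping.single k (component_exponents E d l k)"
    have "?c \<in> multiples (pure_powers (- {l}) (component_exponents E d l))"
      using \<open>k \<noteq> l\<close> by (auto simp: multiples_pure_powers intro!: bexI[of _ k])
    then have "?c \<in> multiples (pure_powers (- {k}) (component_exponents E d k))"
      using sub unfolding kl component_def supported_subset_iff by blast
    then obtain v where "v \<noteq> k" "component_exponents E d k v \<le> 0"
      by (auto simp: multiples_pure_powers lookup_single when_def)
    with component_exponents_pos[of d v E k] d[of v] show False by linarith
  qed
  with kl show "L = J" by simp
qed

theorem corollary8:
  fixes E :: "'v::finite rel" and d :: "'v \<Rightarrow> nat"
  assumes "tournament E" and "acyclic E" and "weighting E d"
  shows "dual_ideal (edge_ideal E d :: ('v, 'k::field) mpoly set) =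
    alexander_dual (edge_ideal E d)"
proof -
  have asym: "asym E" using assms(1) by (simp add: tournament_def oriented_graph_def)
  have d: "d v \<ge> 1" for v using assms(3) by (simp add: weighting_def)
  have irrefl: "(v, v) \<notin> E" for v using asym by (auto dest: asymD)
  (* b k is the exponent of the product of the generators of the k-th component. *)
  define b where
    "b k = (\<Sum>v\<in>- {k}. Poly_Mapping.single v (component_exponents E d k v))" for k
  have b: "Poly_Mapping.lookup (b k) v = (if v = k then 0 else component_exponents E d k v)" for k v
    by (simp add: b_def lookup_sum_single when_def)

  have "(\<Prod>f\<in>min_gens (component E d k). f) = (monom (b k) :: ('v, 'k) mpoly)" for k
    unfolding component_def b_def
    by (intro prod_min_gens_pure_powers component_exponents_pos d)
  then have "(\<lambda>J. \<Prod>f\<in>min_gens J. f) ` range (component E d) = (monom ` range b :: ('v, 'k) mpoly set)"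
    by (simp add: image_image)
  then have alexander: "alexander_dual (edge_ideal E d :: ('v, 'k) mpoly set) = supported (multiples (range b))"
    by (simp add: alexander_dual_def irreducible_components_edge_ideal[OF assms(1,2) d] ideal_gen_monom)

  have "{var v ^ Poly_Mapping.lookup a v | v. Poly_Mapping.lookup a v \<ge> 1} =
      (monom ` pure_powers {v. Poly_Mapping.lookup a v \<ge> 1} (Poly_Mapping.lookup a) :: ('v, 'k) mpoly set)"
    for a :: "'v \<Rightarrow>\<^sub>0 nat"
    by (auto simp: var_power pure_powers_def)
  moreover have "{a. (monom a :: ('v, 'k) mpoly) \<in> min_gens (edge_ideal E d)} = edge_exponents E d"
    using min_gens_edge_ideal[OF asym d, where 'k='k] by (auto simp: image_iff)
  ultimately have dual: "dual_ideal (edge_ideal E d :: ('v, 'k) mpoly set) =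
      supported (\<Inter>a\<in>edge_exponents E d.
        multiples (pure_powers {v. Poly_Mapping.lookup a v \<ge> 1} (Poly_Mapping.lookup a)))"
    by (simp add: dual_ideal_def ideal_gen_monom supported_Inter)

  have dual_iff: "x \<in> (\<Inter>a\<in>edge_exponents E d.
        multiples (pure_powers {v. Poly_Mapping.lookup a v \<ge> 1} (Poly_Mapping.lookup a))) \<longleftrightarrow>
      (\<forall>(u, v)\<in>E. 1 \<le> Poly_Mapping.lookup x u \<or> d v \<le> Poly_Mapping.lookup x v)" for x
  proof -
    have "x \<in> multiples (pure_powers {y. Poly_Mapping.lookup a y \<ge> 1} (Poly_Mapping.lookup a)) \<longleftrightarrow>
        1 \<le> Poly_Mapping.lookup x u \<or> d v \<le> Poly_Mapping.lookup x v"
      if "(u, v) \<in> E" and a: "a = edge_exponent d u v" for a u v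
    proof -
      have "u \<noteq> v" using that irrefl by auto
      then have "Poly_Mapping.lookup a y = (if y = u then 1 else if y = v then d v else 0)" for y
        unfolding a by (rule lookup_edge_exponent)
      then show ?thesis
        using \<open>u \<noteq> v\<close> d[of v] by (auto simp: multiples_pure_powers split: if_splits)
    qed
    then show ?thesis unfolding edge_exponents_def by blast
  qed
  have alexander_iff: "x \<in> multiples (range b) \<longleftrightarrow>
      (\<exists>k. \<forall>v. v \<noteq> k \<longrightarrow> component_exponents E d k v \<le> Poly_Mapping.lookup x v)" for x
    by (auto simp: multiples_iff b)

  have "(\<forall>(u, v)\<in>E. 1 \<le> Poly_Mapping.lookup x u \<or> d v \<le> Poly_Mapping.lookup x v) \<longleftrightarrow>
      (\<exists>k. \<forall>v. v \<noteq> k \<longrightarrow> component_exponents E d k v \<le> Poly_Mapping.lookup x v)" for x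
    \<comment> \<open>The same cut lemma that gave the components, now for the conditions \<open>x\<^sub>i \<ge> 1\<close> and \<open>x\<^sub>j \<ge> d\<^sub>j\<close>.\<close>
    by (simp only: acyclic_tournament_cut[OF assms(1,2)] component_exponents_le_iff)
  then have "(\<Inter>a\<in>edge_exponents E d.
      multiples (pure_powers {v. Poly_Mapping.lookup a v \<ge> 1} (Poly_Mapping.lookup a))) = multiples (range b)"
    by (intro set_eqI) (simp only: dual_iff alexander_iff)
  then show ?thesis by (simp only: dual alexander)
qed

end
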